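(* Let $p=p(n)$ satisfy $\frac{4\log(2e)}{n} < p< \frac{\log n}{3n}$ for all sufficiently large $n$. Then with high probability $G_{n,p}$ does not have the EG Property.
   Context: $\log$ denotes the natural logarithm and $e$ is the base of the natural logarithm. $G_{n,p}$ is the Erdős–Rényi random graph on $n$ labelled vertices in which each of the $\binom n2$ possible edges is present independently with probability $p$. "With high probability" means with probability tending to $1$ as $n\to\infty$. For a graph $G$, $\nu(G)$ denotes the matching number (the size of a largest matching). The size of a graph is its number of edges. Subgraphs of $G$ are taken to have vertex set $V(G)$ and are identified with their edge sets; a "largest subgraph of $G$ with matching number $k$" is a subgraph $H\subseteq G$ with $\nu(H)=k$ having the maximum number of edges among all such subgraphs. A graph $G$ has the EG Property if for each integer $0\le k\le \nu(G)$, every largest subgraph $H$ of $G$ with matching number $k$ has one of the following two forms: (1) there is a set $W\subseteq V(G)$ with $|W|=2k+1$ such that $H$ consists of all edges of $G$ contained in $W$; (2) there is a set $S\subseteq V(G)$ with $|S|=k$ such that $H$ consists of all edges of $G$ meeting $S$ (i.e. having at least one endpoint in $S$). *)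

theory Defs
  imports "HOL-Probability.Probability" "HOL-Library.Ramsey"
begin

text \<open>
  A finite simple graph with vertex set \<open>V\<close> is given by its edge set \<open>E \<subseteq> nsets V 2\<close>, edges being
  two-element sets of vertices. Subgraphs keep the vertex set \<open>V\<close> and so are just subsets of \<open>E\<close>.
\<close>

definition matching :: "'a set set \<Rightarrow> bool" where
  "matching M \<longleftrightarrow> pairwise disjnt M"

text \<open>\<open>Max\<close> is meaningful only for finite edge sets; the empty matching makes its argument nonempty.\<close>

definition matching_number :: "'a set set \<Rightarrow> nat" where
  "matching_number E = Max {card M | M. M \<subseteq> E \<and> matching M}"

definition largest_subgraph_with_matching_number :: "'a set set \<Rightarrow> nat \<Rightarrow> 'a set set \<Rightarrow> bool" where
  "largest_subgraph_with_matching_number E k H \<longleftrightarrow>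
     is_arg_max card (\<lambda>H. H \<subseteq> E \<and> matching_number H = k) H"

definition EG_property :: "'a set \<Rightarrow> 'a set set \<Rightarrow> bool" where
  "EG_property V E \<longleftrightarrow>
     (\<forall>k \<le> matching_number E. \<forall>H. largest_subgraph_with_matching_number E k H \<longrightarrow>
        (\<exists>W \<subseteq> V. card W = 2 * k + 1 \<and> H = {e \<in> E. e \<subseteq> W}) \<or>
        (\<exists>S \<subseteq> V. card S = k \<and> H = {e \<in> E. e \<inter> S \<noteq> {}}))"

text \<open>
  The distribution of the edge set of the Erdos-Renyi random graph on the vertex set \<open>{..<n}\<close>:
  one independent Bernoulli trial per potential edge, keeping the edges whose trial succeeds.
  (\<open>bernoulli_pmf\<close> truncates its parameter to the unit interval.)
\<close>

definition Gnp :: "nat \<Rightarrow> real \<Rightarrow> nat set set pmf" where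
  "Gnp n p = map_pmf (\<lambda>f. {e \<in> nsets {..<n} 2. f e})
     (Pi_pmf (nsets {..<n} 2) False (\<lambda>_. bernoulli_pmf p))"

end

theory Submission
  imports Defs "HOL-Real_Asymp.Real_Asymp"
begin

text \<open>
  For \<open>k = \<nu>(G)\<close> the largest subgraph with matching number \<open>k\<close> is \<open>G\<close> itself, so the EG property would
  confine all edges of \<open>G\<close> to a set of \<open>2k + 1\<close> vertices or give a vertex cover of size \<open>k \<le> n/2\<close>. The
  former fails as soon as \<open>G\<close> has two components that are paths on three vertices: a maximum matching
  covers \<open>2k\<close> vertices and misses one non-isolated vertex in each of these components. The expected
  number of such components is of order at least \<open>n (np)\<^sup>2 e\<^sup>-\<^sup>3\<^sup>n\<^sup>p\<close>, which tends to infinity for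
  \<open>p < ln n / (3n)\<close>, and Chebyshev's inequality applies since distinct components are disjoint. The
  latter would give an independent set of at least half of the vertices, which is excluded by a union
  bound over all vertex sets since \<open>p > 4 ln (2e) / n\<close>.
\<close>

section \<open>Star components: disjointness and uncovered vertices\<close>

text \<open>
  Taking the minimum as the centre of the star leaves one candidate per vertex set, so that candidates
  are counted by a binomial coefficient; this loses only a constant factor in the expectation.
\<close>

definition star :: "nat set \<Rightarrow> nat set set" where
  "star T = (\<lambda>x. {Min T, x}) ` (T - {Min T})"

text \<open>One equation says two things: no edge leaves \<open>T\<close>, and the edges inside
  \<open>T\<close> are exactly those of the star. For \<open>card T = 3\<close> this is a path
  component whose middle vertex is the minimum.\<close>

definition star_component :: "nat set set \<Rightarrow> nat set \<Rightarrow> bool" where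
  "star_component E T \<longleftrightarrow> {e \<in> E. e \<inter> T \<noteq> {}} = star T"

lemma card_star:
  assumes "finite T" "T \<noteq> {}"
  shows "card (star T) = card T - 1"
proof -
  have "inj_on (\<lambda>x. {Min T, x}) (T - {Min T})"
    by (auto simp: inj_on_def doubleton_eq_iff)
  then show ?thesis
    using assms by (simp add: star_def card_image)
qed

lemma star_subset_nsets:
  assumes "finite T" "T \<noteq> {}"
  shows "star T \<subseteq> nsets T 2"
  using Min_in[OF assms] by (auto simp: star_def nsets_def card_2_iff)

lemma star_subset_touching:
  assumes "finite T" "T \<noteq> {}" "T \<subseteq> V"
  shows "star T \<subseteq> {e \<in> nsets V 2. e \<inter> T \<noteq> {}}"
proof
  fix e assume "e \<in> star T"
  then have "e \<in> nsets T 2" using star_subset_nsets assms by blast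
  then show "e \<in> {e \<in> nsets V 2. e \<inter> T \<noteq> {}}"
    using assms nsets_mono[of T V 2] by (auto simp: nsets_def Int_absorb2)
qed

lemma Union_star:
  assumes "finite T" "2 \<le> card T"
  shows "\<Union> (star T) = T"
proof -
  have "T \<noteq> {}" using assms by auto
  then have "Min T \<in> T" using assms by simp
  moreover have "T - {Min T} \<noteq> {}"
  proof
    assume "T - {Min T} = {}"
    then have "card T \<le> card {Min T}" by (intro card_mono) auto
    then show False using assms by simp
  qed
  ultimately show ?thesis by (auto simp: star_def)
qed

text \<open>Any edge of \<open>star T\<close> that meets \<open>T'\<close> belongs to
  \<open>star T'\<close> and so lies inside \<open>T'\<close>. A common vertex thus pulls
  \<open>Min T\<close> into \<open>T'\<close>, and the centre then pulls in all leaves.\<close>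

lemma star_component_subset:
  assumes "star_component E T" "star_component E T'" "T \<inter> T' \<noteq> {}"
    and fin: "finite T" "finite T'" and card: "2 \<le> card T" "2 \<le> card T'"
  shows "T \<subseteq> T'"
proof -
  have edge: "{Min T, x} \<subseteq> T'" if "x \<in> T" "x \<noteq> Min T" "Min T \<in> T' \<or> x \<in> T'" for x
  proof -
    have "{Min T, x} \<in> E"
      using that assms(1) unfolding star_component_def star_def by blast
    then have "{Min T, x} \<in> star T'"
      using that assms(2) unfolding star_component_def by blast
    then show ?thesis
      using Union_star[OF fin(2) card(2)] by blast
  qed
  obtain x where "x \<in> T" "x \<in> T'" using assms(3) by auto
  then have "Min T \<in> T'" using edge[of x] by (cases "x = Min T") auto
  then show ?thesis using edge by blast
qed

lemma star_components_disjoint: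
  assumes "star_component E T" "star_component E T'" "T \<noteq> T'"
    and "finite T" "finite T'" "2 \<le> card T" "2 \<le> card T'"
  shows "T \<inter> T' = {}"
  using star_component_subset[of E T T'] star_component_subset[of E T' T] assms
  by (metis Int_commute subset_antisym)

lemma obtain_two_distinct:
  assumes "2 \<le> card A"
  obtains a b where "a \<in> A" "b \<in> A" "a \<noteq> b"
proof -
  have "finite A" using assms by (intro card_ge_0_finite) simp
  then show thesis using assms that card_le_Suc0_iff_eq[of A] by fastforce
qed

text \<open>Every edge at a leaf contains the centre, so a matching uses at most one of them. With
  at least two leaves, one stays uncovered.\<close>

lemma star_component_unmatched:
  assumes "star_component E T" "finite T" "3 \<le> card T" "M \<subseteq> E" "matching M"
  obtains x where "x \<in> T" "x \<notin> \<Union> M"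
proof -
  have "T \<noteq> {}" using assms by auto
  have "2 \<le> card (T - {Min T})"
    using assms \<open>T \<noteq> {}\<close> by simp
  then obtain a b where ab: "a \<in> T - {Min T}" "b \<in> T - {Min T}" "a \<noteq> b"
    by (rule obtain_two_distinct)
  have only: "e = {Min T, x}" if "e \<in> M" "x \<in> e" "x \<in> T - {Min T}" for e x
  proof -
    have "e \<in> star T"
      using that assms unfolding star_component_def by blast
    then show ?thesis using that by (auto simp: star_def)
  qed
  have "\<not> ({Min T, a} \<in> M \<and> {Min T, b} \<in> M)"
  proof
    assume "{Min T, a} \<in> M \<and> {Min T, b} \<in> M"
    moreover have "{Min T, a} \<noteq> {Min T, b}" using ab by (auto simp: doubleton_eq_iff)
    ultimately have "disjnt {Min T, a} {Min T, b}"
      using pairwiseD[OF assms(5)[unfolded matching_def]] by meson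
    then show False by simp
  qed
  then have "a \<notin> \<Union> M \<or> b \<notin> \<Union> M"
    using only ab by blast
  then show thesis using that ab by blast
qed

section \<open>Maximum matchings and the deterministic criterion\<close>

lemma matching_number_attained:
  assumes "finite E"
  obtains M where "M \<subseteq> E" "matching M" "card M = matching_number E"
proof -
  let ?S = "{card M | M. M \<subseteq> E \<and> matching M}"
  have fin: "finite ?S"
    using assms by (intro finite_subset[of ?S "card ` Pow E"]) auto
  have "card {} \<in> ?S" by (force simp: matching_def)
  then have "?S \<noteq> {}" by (metis empty_iff)
  with fin have "Max ?S \<in> ?S" by (rule Max_in)
  then obtain M where "Max ?S = card M" "M \<subseteq> E" "matching M" by force
  then show thesis using that[of M] by (simp add: matching_number_def)
qed

lemma card_Union_matching:
  assumes "M \<subseteq> nsets V 2" "matching M"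
  shows "card (\<Union> M) = 2 * card M"
proof -
  have "card (\<Union> M) = sum card M"
    using assms by (intro card_Union_disjoint) (auto simp: matching_def nsets_def)
  also have "\<dots> = (\<Sum>e\<in>M. 2)"
    using assms by (intro sum.cong) (auto simp: nsets_def)
  finally show ?thesis by simp
qed

lemma largest_subgraph_matching_number_self:
  assumes "finite E"
  shows "largest_subgraph_with_matching_number E (matching_number E) E"
  using assms by (auto simp: largest_subgraph_with_matching_number_def is_arg_max_def
      not_less intro: card_mono)

text \<open>This isolates what the random graph must supply: two distinct star components rule out
  form (1), and the absence of independent sets on half of the vertices rules out form (2), both at
  \<open>k = matching_number E\<close>.\<close>

lemma not_EG_property:
  assumes V: "finite V" and E: "E \<subseteq> nsets V 2"
    and T: "star_component E T" "finite T" "3 \<le> card T"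
    and T': "star_component E T'" "finite T'" "3 \<le> card T'"
    and "T \<noteq> T'"
    and indep: "\<And>U. U \<subseteq> V \<Longrightarrow> card V \<le> 2 * card U \<Longrightarrow> E \<inter> nsets U 2 \<noteq> {}"
  shows "\<not> EG_property V E"
proof
  assume "EG_property V E"
  have fin: "finite E" using finite_subset[OF E] V by (simp add: finite_imp_finite_nsets)
  obtain M where M: "M \<subseteq> E" "matching M" "card M = matching_number E"
    using matching_number_attained[OF fin] .
  have card_M: "card (\<Union> M) = 2 * matching_number E"
    using card_Union_matching[of M V] M E by auto
  have "\<Union> M \<subseteq> V" using M E by (auto simp: nsets_def)
  then have fin_M: "finite (\<Union> M)" and le: "2 * matching_number E \<le> card V"
    using V card_M card_mono[of V "\<Union> M"] finite_subset by auto
  obtain x where x: "x \<in> T" "x \<notin> \<Union> M" using star_component_unmatched[OF T M(1,2)] .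
  obtain y where y: "y \<in> T'" "y \<notin> \<Union> M" using star_component_unmatched[OF T' M(1,2)] .
  have "T \<inter> T' = {}"
    using star_components_disjoint[OF T(1) T'(1) \<open>T \<noteq> T'\<close>] T(2,3) T'(2,3) by simp
  then have "x \<noteq> y" using x(1) y(1) by blast
  have "star T \<subseteq> E" "star T' \<subseteq> E"
    using T(1) T'(1) unfolding star_component_def by blast+
  moreover have "\<Union> (star T) = T" "\<Union> (star T') = T'"
    using T(2,3) T'(2,3) by (simp_all add: Union_star)
  ultimately have "T \<subseteq> \<Union> E" "T' \<subseteq> \<Union> E" by (metis Union_mono)+
  then have sub: "insert x (insert y (\<Union> M)) \<subseteq> \<Union> E"
    using x(1) y(1) Union_mono[OF M(1)] by (simp add: subset_iff)
  note \<open>EG_property V E\<close>[unfolded EG_property_def, rule_format,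
      OF order_refl largest_subgraph_matching_number_self[OF fin]]
  then consider W where "W \<subseteq> V" "card W = 2 * matching_number E + 1" "E = {e \<in> E. e \<subseteq> W}"
    | S where "S \<subseteq> V" "card S = matching_number E" "E = {e \<in> E. e \<inter> S \<noteq> {}}"
    by auto
  then show False
  proof cases
    case 1
    \<comment> \<open>\<open>W\<close> contains every non-isolated vertex, hence the
      \<open>2k\<close> vertices of \<open>M\<close> together with \<open>x\<close> and
      \<open>y\<close>: one more than its \<open>2k + 1\<close> elements.\<close>
    then have "\<Union> E \<subseteq> W" by blast
    with sub have "insert x (insert y (\<Union> M)) \<subseteq> W" by (rule subset_trans)
    then have "card (insert x (insert y (\<Union> M))) \<le> card W"
      using finite_subset[OF 1(1) V] by (intro card_mono)
    then show False using 1(2) x(2) y(2) \<open>x \<noteq> y\<close> fin_M card_M by simp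
  next
    case 2
    \<comment> \<open>\<open>S\<close> is a vertex cover, so \<open>V - S\<close> is independent; as
      \<open>2k <= card V\<close>, it has at least half of the vertices.\<close>
    have "card (V - S) = card V - matching_number E"
      using 2(1,2) finite_subset[OF 2(1) V] by (simp add: card_Diff_subset)
    then have "E \<inter> nsets (V - S) 2 \<noteq> {}" using le by (intro indep) auto
    then show False using 2 by (auto simp: nsets_def)
  qed
qed

section \<open>Probabilities of star components\<close>

lemma prob_Gnp_restrict:
  assumes "0 \<le> p" "p \<le> 1" "F \<subseteq> D" "D \<subseteq> nsets {..<n} 2"
  shows "measure_pmf.prob (Gnp n p) {E. E \<inter> D = F} = p ^ card F * (1 - p) ^ card (D - F)"
proof -
  let ?N = "nsets {..<n} 2 :: nat set set"
  \<comment> \<open>Trials in \<open>F\<close> must succeed, those in \<open>D - F\<close> must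
    fail, and those outside \<open>D\<close> are free and contribute a factor 1.\<close>
  let ?B = "\<lambda>e. if e \<in> F then {True} else if e \<in> D then {False} else UNIV"
  have fin: "finite ?N" by (simp add: finite_imp_finite_nsets)
  have "measure_pmf.prob (Gnp n p) {E. E \<inter> D = F} =
      measure_pmf.prob (Pi_pmf ?N False (\<lambda>_. bernoulli_pmf p)) {f. {e \<in> ?N. f e} \<inter> D = F}"
    by (simp add: Gnp_def vimage_def)
  also have "{f. {e \<in> ?N. f e} \<inter> D = F} = Pi ?N ?B"
    using assms by (auto simp: Pi_def split: if_splits)
  also have "measure_pmf.prob (Pi_pmf ?N False (\<lambda>_. bernoulli_pmf p)) \<dots> =
      (\<Prod>e\<in>?N. measure_pmf.prob (bernoulli_pmf p) (?B e))"
    by (intro measure_Pi_pmf_Pi fin)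
  also have "\<dots> = (\<Prod>e\<in>?N. if e \<in> F then p else if e \<in> D then 1 - p else 1)"
    using assms by (intro prod.cong) (auto simp: measure_pmf_single)
  also have "\<dots> = (\<Prod>e\<in>D. if e \<in> F then p else 1 - p)"
    using assms fin by (intro prod.mono_neutral_cong_right) auto
  also have "\<dots> = (\<Prod>e\<in>F. p) * (\<Prod>e\<in>D - F. 1 - p)"
    using assms finite_subset[OF assms(4) fin]
    by (subst prod.If_cases) (auto simp: Int_absorb1 Diff_eq)
  finally show ?thesis by simp
qed

lemma nsets_touching_eq:
  "{e \<in> nsets V k. e \<inter> T \<noteq> {}} = nsets V k - nsets (V - T) k"
  by (auto simp: nsets_def)

lemma card_nsets_touching:
  assumes "finite V" "T \<subseteq> V"
  shows "card {e \<in> nsets V k. e \<inter> T \<noteq> {}} = (card V choose k) - ((card V - card T) choose k)"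
proof -
  have "nsets (V - T) k \<subseteq> nsets V k" by (auto simp: nsets_def)
  moreover have "finite (nsets (V - T) k)" using assms by (simp add: finite_imp_finite_nsets)
  ultimately show ?thesis
    using assms unfolding nsets_touching_eq
    by (simp add: card_Diff_subset finite_subset)
qed

lemma AE_Gnp: "AE E in Gnp n p. E \<subseteq> nsets {..<n} 2"
  by (auto simp: AE_measure_pmf_iff Gnp_def)

text \<open>Events need comparing only on the support. This allows \<open>star_component\<close>,
  which inspects all edges of \<open>E\<close>, to be replaced by a condition on the potential edges
  in \<open>D\<close>.\<close>

lemma prob_Gnp_mono:
  assumes "\<And>E. E \<subseteq> nsets {..<n} 2 \<Longrightarrow> E \<in> A \<Longrightarrow> E \<in> B"
  shows "measure_pmf.prob (Gnp n p) A \<le> measure_pmf.prob (Gnp n p) B"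
proof (rule measure_pmf.finite_measure_mono_AE)
  show "AE E in Gnp n p. E \<in> A \<longrightarrow> E \<in> B"
    using AE_Gnp[of n p] by eventually_elim (use assms in blast)
qed simp

lemma prob_Gnp_cong:
  assumes "\<And>E. E \<subseteq> nsets {..<n} 2 \<Longrightarrow> E \<in> A \<longleftrightarrow> E \<in> B"
  shows "measure_pmf.prob (Gnp n p) A = measure_pmf.prob (Gnp n p) B"
  using assms by (intro antisym prob_Gnp_mono) auto

text \<open>A triple is touched by \<open>3 * n - 6\<close> potential edges; two of them must be
  present and the rest absent.\<close>

lemma prob_star_component:
  assumes p: "0 \<le> p" "p \<le> 1" and T: "T \<in> nsets {..<n} 3"
  shows "measure_pmf.prob (Gnp n p) {E. star_component E T} = p ^ 2 * (1 - p) ^ (3 * n - 8)"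
proof -
  define D where "D = {e \<in> nsets {..<n} 2. e \<inter> T \<noteq> {}}"
  have T': "finite T" "T \<noteq> {}" "T \<subseteq> {..<n}" "card T = 3" using T by (auto simp: nsets_def)
  have "3 \<le> n" using T' card_mono[of "{..<n}" T] by simp
  then obtain m where m: "n = m + 3" using le_Suc_ex by (metis add.commute)
  have sub: "star T \<subseteq> D"
    using star_subset_touching[OF T'(1,2,3)] by (simp add: D_def)
  have "card D = (n choose 2) - ((n - 3) choose 2)"
    using card_nsets_touching[of "{..<n}" T 2] T' by (simp add: D_def)
  also have "\<dots> = 3 * n - 6"
    unfolding m by (simp add: numeral_eq_Suc)
  finally have "card (D - star T) = 3 * n - 8"
    using sub T' card_star[OF T'(1,2)] by (simp add: card_Diff_subset finite_subset star_def)
  moreover have "measure_pmf.prob (Gnp n p) {E. star_component E T} =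
      measure_pmf.prob (Gnp n p) {E. E \<inter> D = star T}"
    by (intro prob_Gnp_cong) (auto simp: star_component_def D_def)
  ultimately show ?thesis
    using prob_Gnp_restrict[OF p sub, of n] card_star[OF T'(1,2)] T' by (simp add: D_def)
qed

lemma prob_two_star_components:
  assumes p: "0 \<le> p" "p \<le> 1" and T: "T \<in> nsets {..<n} 3" "T' \<in> nsets {..<n} 3" "T \<noteq> T'"
  shows "measure_pmf.prob (Gnp n p) {E. star_component E T \<and> star_component E T'}
    \<le> p ^ 4 * (1 - p) ^ (6 * n - 25)"
proof (cases "T \<inter> T' = {}")
  \<comment> \<open>Distinct star components cannot overlap, so the event is empty here. Disjoint
    triples are together touched by \<open>6 * n - 21\<close> potential edges, of which four must be
    present.\<close>
  case False
  then have "{E. star_component E T \<and> star_component E T'} = {}"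
    using star_components_disjoint[of _ T T'] T by (auto simp: nsets_def)
  then show ?thesis using p by (simp only: measure_empty) simp
next
  case True
  define D where "D = {e \<in> nsets {..<n} 2. e \<inter> (T \<union> T') \<noteq> {}}"
  define F where "F = star T \<union> star T'"
  have T1: "finite T" "T \<noteq> {}" "T \<subseteq> {..<n}" "card T = 3" using T by (auto simp: nsets_def)
  have T2: "finite T'" "T' \<noteq> {}" "T' \<subseteq> {..<n}" "card T' = 3" using T by (auto simp: nsets_def)
  have card_TT': "card (T \<union> T') = 6" using T1 T2 True by (simp add: card_Un_disjoint)
  have "6 \<le> n" using T1 T2 card_TT' card_mono[of "{..<n}" "T \<union> T'"] by simp
  then obtain m where m: "n = m + 6" using le_Suc_ex by (metis add.commute)
  have sub: "F \<subseteq> D"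
    using star_subset_touching[OF T1(1,2,3)] star_subset_touching[OF T2(1,2,3)]
    unfolding D_def F_def by blast
  have fin: "finite (star T)" "finite (star T')" using T1 T2 by (auto simp: star_def)
  have "star T \<inter> star T' = {}"
    using star_subset_touching[OF T1(1,2), of T] star_subset_touching[OF T2(1,2), of T'] True
    by (fastforce simp: nsets_def)
  then have card_F: "card F = 4"
    using fin card_star[OF T1(1,2)] card_star[OF T2(1,2)] T1 T2
    by (simp add: F_def card_Un_disjoint)
  have "card D = (n choose 2) - ((n - 6) choose 2)"
    using card_nsets_touching[of "{..<n}" "T \<union> T'" 2] T1 T2 card_TT' by (simp add: D_def)
  also have "\<dots> = 6 * n - 21"
    unfolding m by (simp add: numeral_eq_Suc)
  finally have card_D: "card (D - F) = 6 * n - 25"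
    using sub fin card_F by (simp add: card_Diff_subset F_def)
  have "measure_pmf.prob (Gnp n p) {E. star_component E T \<and> star_component E T'} \<le>
      measure_pmf.prob (Gnp n p) {E. E \<inter> D = F}"
    unfolding star_component_def D_def F_def by (intro prob_Gnp_mono) blast
  also have "\<dots> = p ^ 4 * (1 - p) ^ (6 * n - 25)"
    using prob_Gnp_restrict[OF p sub, of n] card_F card_D by (simp add: D_def)
  finally show ?thesis .
qed

section \<open>The second moment method\<close>

text \<open>If the number of occurring events is at most 1, it deviates from its mean
  \<open>\<mu>\<close> by at least \<open>\<mu> - 1\<close>, which is positive, so Chebyshev's
  inequality applies. The double sum is the second moment.\<close>

lemma (in prob_space) second_moment_two_events:
  assumes "finite I" and A: "\<And>i. i \<in> I \<Longrightarrow> A i \<in> events"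
    and \<mu>: "\<mu> = (\<Sum>i\<in>I. prob (A i))" "1 < \<mu>"
  shows "prob {x \<in> space M. card {i \<in> I. x \<in> A i} \<le> 1}
    \<le> ((\<Sum>i\<in>I. \<Sum>j\<in>I. prob (A i \<inter> A j)) - \<mu>\<^sup>2) / (\<mu> - 1)\<^sup>2"
proof -
  define X where "X x = (\<Sum>i\<in>I. indicator (A i) x :: real)" for x
  have X_sq: "(X x)\<^sup>2 = (\<Sum>i\<in>I. \<Sum>j\<in>I. indicator (A i \<inter> A j) x)" for x
    by (simp add: X_def power2_eq_square sum_product indicator_inter_arith)
  have X_card: "X x = real (card {i \<in> I. x \<in> A i})" for x
    using \<open>finite I\<close> by (simp add: X_def indicator_def sum.If_cases Int_def)
  have int: "integrable M (indicator (A i) :: _ \<Rightarrow> real)" if "i \<in> I" for i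
    using A[OF that] by (simp add: emeasure_eq_measure)
  have int2: "integrable M (indicator (A i \<inter> A j) :: _ \<Rightarrow> real)" if "i \<in> I" "j \<in> I" for i j
    using A that by (simp add: emeasure_eq_measure)
  have int_X: "integrable M X" unfolding X_def using int by auto
  have int_X2: "integrable M (\<lambda>x. (X x)\<^sup>2)" unfolding X_sq using int2 by auto
  have ex: "expectation X = \<mu>"
    unfolding X_def \<mu>(1) using int A by (simp add: Bochner_Integration.integral_sum)
  have ex2: "expectation (\<lambda>x. (X x)\<^sup>2) = (\<Sum>i\<in>I. \<Sum>j\<in>I. prob (A i \<inter> A j))"
    unfolding X_sq using int2 A by (simp add: Bochner_Integration.integral_sum)
  have "{x \<in> space M. card {i \<in> I. x \<in> A i} \<le> 1} \<subseteq>
      {x \<in> space M. \<mu> - 1 \<le> \<bar>X x - expectation X\<bar>}"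
    unfolding ex X_card by auto
  then have "prob {x \<in> space M. card {i \<in> I. x \<in> A i} \<le> 1} \<le>
      prob {x \<in> space M. \<mu> - 1 \<le> \<bar>X x - expectation X\<bar>}"
    using borel_measurable_integrable[OF int_X] by (intro finite_measure_mono) measurable
  also have "\<dots> \<le> variance X / (\<mu> - 1)\<^sup>2"
    using int_X int_X2 \<mu> by (intro Chebyshev_inequality) auto
  also have "variance X = (\<Sum>i\<in>I. \<Sum>j\<in>I. prob (A i \<inter> A j)) - \<mu>\<^sup>2"
    using variance_eq[OF int_X int_X2] ex ex2 by simp
  finally show ?thesis .
qed

lemma prob_few_star_components:
  assumes p: "0 \<le> p" "p < 1" and n: "6 \<le> n"
    and \<mu>: "\<mu> = real (n choose 3) * (p ^ 2 * (1 - p) ^ (3 * n - 8))" "1 < \<mu>"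
  shows "measure_pmf.prob (Gnp n p) {E. card {T \<in> nsets {..<n} 3. star_component E T} \<le> 1}
    \<le> (\<mu> + \<mu>\<^sup>2 * (1 / (1 - p) ^ 9 - 1)) / (\<mu> - 1)\<^sup>2"
proof -
  let ?I = "nsets {..<n} 3 :: nat set set"
  let ?A = "\<lambda>T. {E. star_component E T}"
  let ?P = "measure_pmf.prob (Gnp n p)"
  let ?s = "p ^ 2 * (1 - p) ^ (3 * n - 8)"
  have fin: "finite ?I" by (simp add: finite_imp_finite_nsets)
  have sum: "\<mu> = (\<Sum>T\<in>?I. ?P (?A T))"
    using p by (simp add: prob_star_component \<mu>)
  \<comment> \<open>The 9 potential edges between two disjoint triples must be absent for both; the
    product of the single probabilities counts them twice, whence the correction
    \<open>(1 - p) ^ 9\<close>.\<close>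
  have pow: "p ^ 4 * (1 - p) ^ (6 * n - 25) = ?s\<^sup>2 / (1 - p) ^ 9"
  proof -
    have "2 * (3 * n - 8) = 6 * n - 25 + 9" using n by simp
    then have "((1 - p) ^ (3 * n - 8))\<^sup>2 = (1 - p) ^ (6 * n - 25) * (1 - p) ^ 9"
      by (metis power_add power_mult mult.commute)
    then show ?thesis using p by (simp add: field_simps flip: power_mult)
  qed
  \<comment> \<open>The diagonal pairs sum to \<open>\<mu>\<close>; the bound for distinct triples
    is added to every pair, diagonal ones included, giving the term in
    \<open>\<mu>\<^sup>2\<close>.\<close>
  have "(\<Sum>T\<in>?I. \<Sum>T'\<in>?I. ?P (?A T \<inter> ?A T')) \<le>
      (\<Sum>T\<in>?I. \<Sum>T'\<in>?I. (if T' = T then ?s else 0) + ?s\<^sup>2 / (1 - p) ^ 9)"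
  proof (intro sum_mono)
    fix T T' assume T: "T \<in> ?I" "T' \<in> ?I"
    show "?P (?A T \<inter> ?A T') \<le> (if T' = T then ?s else 0) + ?s\<^sup>2 / (1 - p) ^ 9"
    proof (cases "T' = T")
      case True
      then show ?thesis using p prob_star_component[of p T n] T by simp
    next
      case False
      have "?P (?A T \<inter> ?A T') \<le> p ^ 4 * (1 - p) ^ (6 * n - 25)"
        using prob_two_star_components[of p T n T'] False p T by (simp add: Collect_conj_eq)
      then show ?thesis using pow False by simp
    qed
  qed
  also have "\<dots> = \<mu> + \<mu>\<^sup>2 / (1 - p) ^ 9"
    using fin by (simp add: sum.distrib \<mu> algebra_simps power2_eq_square)
  finally have "(\<Sum>T\<in>?I. \<Sum>T'\<in>?I. ?P (?A T \<inter> ?A T')) - \<mu>\<^sup>2 \<le>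
      \<mu> + \<mu>\<^sup>2 * (1 / (1 - p) ^ 9 - 1)"
    by (simp add: algebra_simps)
  moreover have "?P {E. card {T \<in> ?I. star_component E T} \<le> 1} \<le>
      ((\<Sum>T\<in>?I. \<Sum>T'\<in>?I. ?P (?A T \<inter> ?A T')) - \<mu>\<^sup>2) / (\<mu> - 1)\<^sup>2"
    using measure_pmf.second_moment_two_events[of ?I ?A "Gnp n p" \<mu>] fin sum \<mu>(2) by simp
  ultimately show ?thesis
    by (smt (verit) divide_right_mono zero_le_power2)
qed

section \<open>Independent sets on half of the vertices\<close>

lemma real_choose_two: "real (m choose 2) = real m * (real m - 1) / 2"
  by (induction m) (auto simp: numeral_2_eq_2 field_simps)

text \<open>Union bound over at most \<open>2 ^ n\<close> sets: each has at least
  \<open>n / 2\<close> vertices, hence at least \<open>n (n - 2) / 8\<close> pairs, all of which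
  must be non-edges.\<close>

lemma prob_large_independent_set:
  assumes "0 \<le> p" "p \<le> 1"
  shows "measure_pmf.prob (Gnp n p) {E. \<exists>U\<subseteq>{..<n}. n \<le> 2 * card U \<and> E \<inter> nsets U 2 = {}}
    \<le> 2 ^ n * exp (- p * (real n * (real n - 2) / 8))"
proof -
  let ?U = "{U. U \<subseteq> {..<n} \<and> n \<le> 2 * card U}"
  let ?P = "measure_pmf.prob (Gnp n p)"
  let ?b = "exp (- p * (real n * (real n - 2) / 8))"
  have fin: "finite ?U" by (rule finite_subset[of _ "Pow {..<n}"]) auto
  have card_le: "card ?U \<le> 2 ^ n"
    using card_mono[of "Pow {..<n}" ?U] by (auto simp: card_Pow)
  have bound: "?P {E. E \<inter> nsets U 2 = {}} \<le> ?b" if "U \<in> ?U" for U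
  proof -
    have "?P {E. E \<inter> nsets U 2 = {}} = (1 - p) ^ (card U choose 2)"
      using prob_Gnp_restrict[of p "{}" "nsets U 2" n] that assms
      by (simp add: nsets_mono)
    also have "\<dots> \<le> exp (- p) ^ (card U choose 2)"
      using assms exp_ge_add_one_self[of "- p"] by (intro power_mono) auto
    also have "\<dots> = exp (- p * real (card U choose 2))"
      by (simp flip: exp_of_nat_mult add: mult.commute)
    also have "\<dots> \<le> ?b"
    proof -
      have le: "real n \<le> 2 * real (card U)" using that by simp
      have "real n * (real n - 2) \<le> 2 * real (card U) * (2 * real (card U) - 2)"
      \<comment> \<open>Monotonicity of products needs \<open>real n - 2\<close> nonnegative; for
        smaller \<open>n\<close> the left side is at most 0.\<close>
      proof (cases "2 \<le> n")
        case True
        then show ?thesis using le by (intro mult_mono) auto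
      next
        case False
        then have "real n * (real n - 2) \<le> 0" by (simp add: mult_nonneg_nonpos)
        also have "0 \<le> 2 * real (card U) * (2 * real (card U) - 2)"
          by (cases "card U") auto
        finally show ?thesis .
      qed
      also have "\<dots> = 8 * real (card U choose 2)"
        by (simp add: real_choose_two algebra_simps)
      finally have "real n * (real n - 2) / 8 \<le> real (card U choose 2)" by simp
      then show ?thesis using mult_left_mono[OF _ assms(1)] by fastforce
    qed
    finally show ?thesis .
  qed
  have "?P {E. \<exists>U\<subseteq>{..<n}. n \<le> 2 * card U \<and> E \<inter> nsets U 2 = {}} =
      ?P (\<Union>U\<in>?U. {E. E \<inter> nsets U 2 = {}})"
    by (intro arg_cong[where f = ?P]) auto
  also have "\<dots> \<le> (\<Sum>U\<in>?U. ?P {E. E \<inter> nsets U 2 = {}})"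
    using fin by (intro measure_pmf.finite_measure_subadditive_finite) auto
  also have "\<dots> \<le> (\<Sum>U\<in>?U. ?b)"
    using bound by (intro sum_mono) auto
  also have "\<dots> \<le> 2 ^ n * ?b"
    using card_le by (simp add: mult_right_mono flip: of_nat_le_iff)
  finally show ?thesis .
qed

section \<open>The two exceptional events and the growth of the expectation\<close>

lemma prob_EG_property_le:
  "measure_pmf.prob (Gnp n p) {E. EG_property {..<n} E} \<le>
    measure_pmf.prob (Gnp n p) {E. card {T \<in> nsets {..<n} 3. star_component E T} \<le> 1} +
    measure_pmf.prob (Gnp n p) {E. \<exists>U\<subseteq>{..<n}. n \<le> 2 * card U \<and> E \<inter> nsets U 2 = {}}"
proof -
  let ?P = "measure_pmf.prob (Gnp n p)"
  let ?A = "{E. card {T \<in> nsets {..<n} 3. star_component E T} \<le> 1}"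
  let ?B = "{E. \<exists>U\<subseteq>{..<n}. n \<le> 2 * card U \<and> E \<inter> nsets U 2 = {}}"
  have *: "E \<in> ?A \<union> ?B" if "E \<subseteq> nsets {..<n} 2" "EG_property {..<n} E" for E
  proof (rule ccontr)
    assume neg: "E \<notin> ?A \<union> ?B"
    then have "2 \<le> card {T \<in> nsets {..<n} 3. star_component E T}" by auto
    then obtain T T' where "T \<in> nsets {..<n} 3" "star_component E T"
      "T' \<in> nsets {..<n} 3" "star_component E T'" "T \<noteq> T'"
      by (rule obtain_two_distinct) auto
    then show False
      using not_EG_property[of "{..<n}" E T T'] that neg by (auto simp: nsets_def)
  qed
  have "?P {E. EG_property {..<n} E} \<le> ?P (?A \<union> ?B)"
    using * by (intro prob_Gnp_mono) blast
  also have "\<dots> \<le> ?P ?A + ?P ?B"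
    by (intro measure_subadditive) auto
  finally show ?thesis .
qed

text \<open>With \<open>c = n p\<close>, the expectation is at least
  \<open>c\<^sup>2 n exp (-3c) / (27 e)\<close>, and the range of \<open>c\<close> forces this to
  grow at least like the square of \<open>ln n\<close>.\<close>

lemma expected_star_components_at_top:
  fixes p :: "nat \<Rightarrow> real"
  assumes "\<forall>\<^sub>F n in sequentially. 1 \<le> real n * p n \<and> real n * p n \<le> ln (real n) / 3"
  shows "filterlim (\<lambda>n. real (n choose 3) * (p n ^ 2 * (1 - p n) ^ (3 * n - 8))) at_top sequentially"
proof (rule filterlim_at_top_mono)
  \<comment> \<open>Here \<open>972 = 36 * 27\<close>: 36 comes from splitting the range of
    \<open>c\<close> at \<open>ln n / 6\<close>, 27 from \<open>(n/3) ^ 3 <= n choose 3\<close>, and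
    \<open>exp (- 1)\<close> absorbs the second-order error in \<open>ln (1 - p)\<close>.\<close>
  show "filterlim (\<lambda>n. exp (- 1) * (ln (real n))\<^sup>2 / 972) at_top sequentially"
    by real_asymp
  \<comment> \<open>In turn, these give \<open>p n <= 1/2\<close> for the logarithm bound, control
    its second-order term, and settle the case of small \<open>c\<close>.\<close>
  have "\<forall>\<^sub>F n in sequentially. ln (real n) / (3 * real n) \<le> 1 / 2" by real_asymp
  moreover have "\<forall>\<^sub>F n in sequentially. 6 * ((ln (real n))\<^sup>2 / (9 * real n)) \<le> 1" by real_asymp
  moreover have "\<forall>\<^sub>F n in sequentially. (ln (real n))\<^sup>2 / 36 \<le> real n powr (1 / 2)" by real_asymp
  ultimately show "\<forall>\<^sub>F n in sequentially. exp (- 1) * (ln (real n))\<^sup>2 / 972 \<le>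
      real (n choose 3) * (p n ^ 2 * (1 - p n) ^ (3 * n - 8))"
    using assms eventually_ge_at_top[of 6]
  proof eventually_elim
    case (elim n)
    define c where "c = real n * p n"
    have c: "1 \<le> c" "c \<le> ln (real n) / 3" using elim by (auto simp: c_def)
    have n: "0 < real n" using elim by simp
    have pn: "p n = c / real n" using n by (simp add: c_def)
    have p: "0 \<le> p n" using c n by (simp add: pn)
    have "p n \<le> ln (real n) / (3 * real n)" using c n by (simp add: pn field_simps)
    then have p2: "p n \<le> 1 / 2" using elim(1) by linarith
    have "c\<^sup>2 \<le> (ln (real n) / 3)\<^sup>2" using c by (intro power_mono) auto
    then have "c\<^sup>2 / real n \<le> (ln (real n))\<^sup>2 / (9 * real n)"
      using n by (simp add: field_simps)
    then have small: "6 * (c\<^sup>2 / real n) \<le> 1" using elim(2) by linarith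
    \<comment> \<open>The factors \<open>c\<^sup>2\<close> and \<open>n exp (-3c)\<close> cannot both be small: the first is large for \<open>c\<close> close to
      \<open>ln n / 3\<close>, and the second is at least \<open>sqrt n\<close> for \<open>c \<le> ln n / 6\<close>.\<close>
    have "(ln (real n))\<^sup>2 / 36 \<le> c\<^sup>2 * (real n * exp (- 3 * c))"
    proof (cases "ln (real n) / 6 \<le> c")
      case True
      have "exp (- ln (real n)) \<le> exp (- 3 * c)" using c by simp
      then have "1 \<le> real n * exp (- 3 * c)" using n by (simp add: exp_minus field_simps)
      moreover have "(ln (real n) / 6)\<^sup>2 \<le> c\<^sup>2"
        using True elim by (intro power_mono) auto
      ultimately show ?thesis
        using mult_mono[of "(ln (real n) / 6)\<^sup>2" "c\<^sup>2" 1 "real n * exp (- 3 * c)"]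
        by (simp add: power_divide)
    next
      case False
      have "real n powr (1 / 2) = exp (ln (real n) + - (ln (real n) / 2))"
        using n by (simp add: powr_def)
      also have "\<dots> \<le> exp (ln (real n) + - 3 * c)" using False by simp
      also have "\<dots> = real n * exp (- 3 * c)" using n by (simp only: exp_add exp_ln)
      also have "\<dots> \<le> c\<^sup>2 * (real n * exp (- 3 * c))"
        using mult_right_mono[OF one_le_power[OF c(1)], of "real n * exp (- 3 * c)" 2] n by simp
      finally show ?thesis using elim by linarith
    qed
    \<comment> \<open>Uses \<open>ln (1 - p) >= - p - 2 p\<^sup>2\<close>. Over \<open>3n\<close>
      factors the quadratic term costs \<open>6 c\<^sup>2 / n\<close>, which is at most 1.\<close>
    moreover have "exp (- 3 * c) * exp (- 1) \<le> (1 - p n) ^ (3 * n - 8)"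
    proof -
      have "exp (- 3 * c) * exp (- 1) \<le> exp (- 3 * c) * exp (- 6 * (c\<^sup>2 / real n))"
        using small by simp
      also have "\<dots> = exp (real (3 * n) * (- p n - 2 * (p n)\<^sup>2))"
        using n by (simp add: pn field_simps power2_eq_square flip: exp_add)
      also have "\<dots> \<le> exp (real (3 * n) * ln (1 - p n))"
        using ln_one_minus_pos_lower_bound[OF p p2] by (simp add: mult_left_mono)
      also have "\<dots> = (1 - p n) ^ (3 * n)"
        using p2 by (subst exp_of_nat_mult) simp
      also have "\<dots> \<le> (1 - p n) ^ (3 * n - 8)"
        using p p2 by (intro power_decreasing) auto
      finally show ?thesis .
    qed
    moreover have "(real n / 3) ^ 3 \<le> real (n choose 3)"
      using binomial_ge_n_over_k_pow_k[of 3 n, where 'a = real] elim by simp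
    ultimately have "((ln (real n))\<^sup>2 / 36) * (exp (- 1) / 27) \<le>
        c\<^sup>2 * (real n * exp (- 3 * c)) * (exp (- 1) / 27)"
      and "(real n / 3) ^ 3 * ((p n)\<^sup>2 * (exp (- 3 * c) * exp (- 1))) \<le>
        real (n choose 3) * ((p n)\<^sup>2 * (1 - p n) ^ (3 * n - 8))"
      by (intro mult_right_mono mult_mono mult_left_mono; simp)+
    moreover have "c\<^sup>2 * (real n * exp (- 3 * c)) * (exp (- 1) / 27) =
        (real n / 3) ^ 3 * ((p n)\<^sup>2 * (exp (- 3 * c) * exp (- 1)))"
      by (simp add: c_def power2_eq_square power3_eq_cube)
    ultimately have "((ln (real n))\<^sup>2 / 36) * (exp (- 1) / 27) \<le>
        real (n choose 3) * ((p n)\<^sup>2 * (1 - p n) ^ (3 * n - 8))"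
      by linarith
    then show ?case by (simp add: mult.commute)
  qed
qed

section \<open>Combining the limits\<close>

theorem theorem4p4:
  fixes p :: "nat \<Rightarrow> real"
  assumes "\<forall>\<^sub>F n in sequentially.
             4 * ln (2 * exp 1) / real n < p n \<and> p n < ln (real n) / (3 * real n)"
  shows "(\<lambda>n. measure_pmf.prob (Gnp n (p n)) {E. \<not> EG_property {..<n} E}) \<longlonglongrightarrow> 1"
proof -
  let ?P = "\<lambda>n. measure_pmf.prob (Gnp n (p n))"
  define \<mu> where "\<mu> n = real (n choose 3) * (p n ^ 2 * (1 - p n) ^ (3 * n - 8))" for n
  have ln_2e: "ln (2 * exp 1) = ln 2 + (1::real)" by (simp add: ln_mult)
  have pos: "\<forall>\<^sub>F n in sequentially. 0 < p n"
    using assms eventually_gt_at_top[of 0]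
  proof eventually_elim
    case (elim n)
    have "0 < 4 * ln (2 * exp 1) / real n" using elim by (simp add: ln_2e add_pos_pos)
    then show ?case using elim by linarith
  qed
  have "(\<lambda>n::nat. ln (real n) / (3 * real n)) \<longlonglongrightarrow> 0" by real_asymp
  then have p_0: "p \<longlonglongrightarrow> 0"
    by (rule tendsto_sandwich[OF _ _ tendsto_const, rotated 2])
       (use assms pos in \<open>auto elim: eventually_mono\<close>)
  have lt_1: "\<forall>\<^sub>F n in sequentially. p n < 1"
    by (rule order_tendstoD[OF p_0]) simp
  have \<mu>_top: "filterlim \<mu> at_top sequentially"
    unfolding \<mu>_def
  proof (rule expected_star_components_at_top)
    show "\<forall>\<^sub>F n in sequentially. 1 \<le> real n * p n \<and> real n * p n \<le> ln (real n) / 3"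
      using assms eventually_gt_at_top[of 0]
    proof eventually_elim
      case (elim n)
      then have "4 * ln (2 * exp 1) < real n * p n" "real n * p n < ln (real n) / 3"
        by (simp_all add: field_simps)
      moreover have "1 * 1 \<le> 4 * ln (2 * exp (1::real))"
        unfolding ln_2e by (intro mult_mono) auto
      ultimately show ?case
        by (metis less_imp_le mult_1 order_le_less_trans)
    qed
  qed
  have inv_\<mu>: "(\<lambda>n. 1 / \<mu> n) \<longlonglongrightarrow> 0"
    using tendsto_divide_0[OF tendsto_const filterlim_at_top_imp_at_infinity[OF \<mu>_top]] .
  \<comment> \<open>This is the Chebyshev bound with numerator and denominator divided by
    \<open>\<mu>\<^sup>2\<close>; it vanishes because \<open>\<mu>\<close> tends to infinity and
    \<open>p\<close> to 0.\<close>
  have "(\<lambda>n. (1 / \<mu> n + (1 / (1 - p n) ^ 9 - 1)) / (1 - 1 / \<mu> n)\<^sup>2)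
      \<longlonglongrightarrow> (0 + (1 / (1 - 0) ^ 9 - 1)) / (1 - 0)\<^sup>2"
    by (intro tendsto_intros inv_\<mu> p_0) auto
  then have lim1: "(\<lambda>n. (1 / \<mu> n + (1 / (1 - p n) ^ 9 - 1)) / (1 - 1 / \<mu> n)\<^sup>2) \<longlonglongrightarrow> 0"
    by simp
  \<comment> \<open>Putting \<open>4 ln (2e) / n\<close> for \<open>p\<close> in
    \<open>n ln 2 - p n (n - 2) / 8\<close> leaves the exponent of \<open>lim2\<close>; its leading
    coefficient is negative because \<open>ln 2 < 1\<close>.\<close>
  have "(ln 2 - 1) / 2 < (0::real)" using ln_2_less_1 by simp
  then have lim2: "(\<lambda>n. exp ((ln 2 - 1) / 2 * real n + (ln 2 + 1))) \<longlonglongrightarrow> 0"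
    by real_asymp
  have "\<forall>\<^sub>F n in sequentially. 1 < \<mu> n"
    using \<mu>_top by (simp add: filterlim_at_top_dense)
  then have "\<forall>\<^sub>F n in sequentially. ?P n {E. EG_property {..<n} E} \<le>
      (1 / \<mu> n + (1 / (1 - p n) ^ 9 - 1)) / (1 - 1 / \<mu> n)\<^sup>2 +
      exp ((ln 2 - 1) / 2 * real n + (ln 2 + 1))"
    using assms pos lt_1 eventually_ge_at_top[of 6]
  proof eventually_elim
    case (elim n)
    have "?P n {E. card {T \<in> nsets {..<n} 3. star_component E T} \<le> 1} \<le>
        (\<mu> n + (\<mu> n)\<^sup>2 * (1 / (1 - p n) ^ 9 - 1)) / (\<mu> n - 1)\<^sup>2"
      using elim by (intro prob_few_star_components) (auto simp: \<mu>_def)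
    also have "\<dots> = (1 / \<mu> n + (1 / (1 - p n) ^ 9 - 1)) / (1 - 1 / \<mu> n)\<^sup>2"
    proof -
      have "\<mu> n + (\<mu> n)\<^sup>2 * b = (\<mu> n)\<^sup>2 * (1 / \<mu> n + b)" for b
        using elim by (simp add: field_simps power2_eq_square)
      moreover have "(\<mu> n - 1)\<^sup>2 = (\<mu> n)\<^sup>2 * (1 - 1 / \<mu> n)\<^sup>2"
        using elim by (simp add: field_simps flip: power_mult_distrib)
      ultimately show ?thesis using elim by simp
    qed
    finally have 1: "?P n {E. card {T \<in> nsets {..<n} 3. star_component E T} \<le> 1} \<le> \<dots>" .
    have "?P n {E. \<exists>U\<subseteq>{..<n}. n \<le> 2 * card U \<and> E \<inter> nsets U 2 = {}} \<le>
        2 ^ n * exp (- p n * (real n * (real n - 2) / 8))"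
      using elim by (intro prob_large_independent_set) auto
    also have "\<dots> = exp (real n * ln 2 - p n * (real n * (real n - 2) / 8))"
    proof -
      have "(2::real) ^ n = exp (real n * ln 2)" by (subst exp_of_nat_mult) simp
      then show ?thesis by (simp flip: exp_add)
    qed
    also have "\<dots> \<le> exp ((ln 2 - 1) / 2 * real n + (ln 2 + 1))"
    proof -
      have "4 * (ln 2 + 1) / real n * (real n * (real n - 2) / 8) \<le>
          p n * (real n * (real n - 2) / 8)"
        using elim by (intro mult_right_mono) (auto simp: ln_2e)
      moreover have "4 * (ln 2 + 1) / real n * (real n * (real n - 2) / 8) =
          (ln 2 + 1) * (real n - 2) / 2"
        using elim by (simp add: field_simps)
      ultimately have "(ln 2 + 1) * (real n - 2) / 2 \<le> p n * (real n * (real n - 2) / 8)"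
        by (simp only:)
      moreover have "real n * ln 2 - (ln 2 + 1) * (real n - 2) / 2 =
          (ln 2 - 1) / 2 * real n + (ln 2 + 1)"
        by (simp add: field_simps)
      ultimately show ?thesis by (simp only: exp_le_cancel_iff)
    qed
    finally show ?case using 1 prob_EG_property_le[of n "p n"] by linarith
  qed
  then have "(\<lambda>n. ?P n {E. EG_property {..<n} E}) \<longlonglongrightarrow> 0"
    by (rule tendsto_sandwich[OF _ _ tendsto_const tendsto_add_zero[OF lim1 lim2], rotated])
       simp
  then have "(\<lambda>n. 1 - ?P n {E. EG_property {..<n} E}) \<longlonglongrightarrow> 1 - 0"
    by (intro tendsto_intros)
  moreover have "?P n {E. \<not> EG_property {..<n} E} = 1 - ?P n {E. EG_property {..<n} E}" for n
    using measure_pmf.prob_compl[of "{E. EG_property {..<n} E}" "Gnp n (p n)"]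
    by (simp add: Compl_eq_Diff_UNIV[symmetric] Collect_neg_eq)
  ultimately show ?thesis by simp
qed

end
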